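(* Let $r\ge 2$ and $t\ge 1$ be integers and let $F$ be a graph. Then for every $n$ there is an $F$-free blue-red graph $G$ on $n$ vertices such that $$ex_r(n,\mathbb{B}_t^rF)\le \mathcal{N}(K_r,G_{blue})+t|E(G_{red})|+(t-1)\left(\binom{n}{2}-|E(G)|\right).$$
   Context: All graphs are finite and simple. A hypergraph consists of a finite vertex set and a set of distinct subsets of it (hyperedges); it is $r$-uniform if all hyperedges have size $r$. For an integer $t\ge1$ and a graph $F$, a hypergraph $\mathcal{F}$ is a $t$-wise Berge copy of $F$ if $|E(\mathcal{F})|=t|E(F)|$ and there exist an injection $i:V(F)\to V(\mathcal{F})$ and a map $h$ assigning to each edge $e$ of $F$ a set $h(e)$ of $t$ hyperedges of $\mathcal{F}$ such that $h(e)\cap h(e')=\emptyset$ for distinct edges $e,e'$ of $F$, and for every edge $e=xy$ of $F$ we have $\{i(x),i(y)\}\subseteq A$ for all $A\in h(e)$. $\mathbb{B}_t^rF$ denotes the family of $r$-uniform $t$-wise Berge copies of $F$. $ex_r(n,\mathbb{F})$ is the maximum number of hyperedges in an $r$-uniform hypergraph on $n$ vertices that contains no member of the family $\mathbb{F}$ as a subhypergraph. A blue-red graph is a graph each of whose edges is colored blue or red; $G_{blue}$ and $G_{red}$ are the spanning subgraphs formed by the blue and red edges. $\mathcal{N}(K_r,H)$ is the number of copies of $K_r$ in a graph $H$. $G$ being $F$-free means $G$ (ignoring colors) contains no subgraph isomorphic to $F$.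
   Formalization: It is additionally assumed that F has at least one edge or that n < |V(F)|; otherwise every graph on n vertices contains F, so no F-free graph on n vertices exists and the claim fails. *)

theory Defs
  imports Main
begin

record 'a hypergraph =
  verts :: "'a set"
  edges :: "'a set set"

definition wf_hypergraph :: "'a hypergraph \<Rightarrow> bool" where
  "wf_hypergraph H \<longleftrightarrow> finite (verts H) \<and> (\<forall>A\<in>edges H. A \<subseteq> verts H)"

definition uniform :: "nat \<Rightarrow> 'a hypergraph \<Rightarrow> bool" where
  "uniform r H \<longleftrightarrow> (\<forall>A\<in>edges H. card A = r)"

definition simple_graph :: "'a hypergraph \<Rightarrow> bool" where
  "simple_graph G \<longleftrightarrow> wf_hypergraph G \<and> uniform 2 G"

definition subhypergraph :: "'a hypergraph \<Rightarrow> 'a hypergraph \<Rightarrow> bool" where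
  "subhypergraph S H \<longleftrightarrow> wf_hypergraph S \<and> verts S \<subseteq> verts H \<and> edges S \<subseteq> edges H"

definition isomorphic :: "'a hypergraph \<Rightarrow> 'b hypergraph \<Rightarrow> bool" where
  "isomorphic F S \<longleftrightarrow> (\<exists>f. bij_betw f (verts F) (verts S) \<and> edges S = (\<lambda>A. f ` A) ` edges F)"

definition copies :: "'a hypergraph \<Rightarrow> 'b hypergraph \<Rightarrow> 'b hypergraph set" where
  "copies F H = {S. subhypergraph S H \<and> isomorphic F S}"

definition free :: "'a hypergraph \<Rightarrow> 'b hypergraph \<Rightarrow> bool" where
  "free F H \<longleftrightarrow> copies F H = {}"

definition complete_graph :: "nat \<Rightarrow> nat hypergraph" where
  "complete_graph r = \<lparr>verts = {..<r}, edges = {e. e \<subseteq> {..<r} \<and> card e = 2}\<rparr>"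

definition num_cliques :: "nat \<Rightarrow> 'a hypergraph \<Rightarrow> nat" where
  "num_cliques r H = card (copies (complete_graph r) H)"

definition berge_copies :: "nat \<Rightarrow> nat \<Rightarrow> 'a hypergraph \<Rightarrow> 'b hypergraph set" where
  "berge_copies t r F = {H. wf_hypergraph H \<and> uniform r H \<and>
     card (edges H) = t * card (edges F) \<and>
     (\<exists>i h. inj_on i (verts F) \<and> i ` verts F \<subseteq> verts H \<and>
        (\<forall>e\<in>edges F. h e \<subseteq> edges H \<and> card (h e) = t) \<and>
        (\<forall>e\<in>edges F. \<forall>e'\<in>edges F. e \<noteq> e' \<longrightarrow> h e \<inter> h e' = {}) \<and>
        (\<forall>x y. {x, y} \<in> edges F \<longrightarrow> (\<forall>A\<in>h {x, y}. {i x, i y} \<subseteq> A)))}"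

text \<open>Every finite hypergraph has an isomorphic copy on natural numbers, so it suffices to
  range over those. The maximum is unspecified if no hypergraph qualifies, that is, if the
  family has a member with no hyperedges and at most \<open>n\<close> vertices.\<close>

definition ex_number :: "nat \<Rightarrow> nat \<Rightarrow> nat hypergraph set \<Rightarrow> nat" where
  "ex_number r n \<F> = Max {card (edges H) | H :: nat hypergraph.
     wf_hypergraph H \<and> uniform r H \<and> card (verts H) = n \<and> (\<forall>S\<in>\<F>. free S H)}"

text \<open>A blue-red graph is a graph \<open>G\<close> with a colouring \<open>c\<close>, of which only the values on
  \<open>edges G\<close> matter.\<close>

datatype colour = Blue | Red

definition colour_subgraph :: "'a hypergraph \<Rightarrow> ('a set \<Rightarrow> colour) \<Rightarrow> colour \<Rightarrow> 'a hypergraph" where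
  "colour_subgraph G c k = \<lparr>verts = verts G, edges = {e \<in> edges G. c e = k}\<rparr>"

end

(* Assign hyperedges to vertex pairs they contain, each pair receiving at most t hyperedges, so that
   as many hyperedges as possible are assigned. The pairs receiving exactly t hyperedges form G: a
   copy of F in G would yield a t-wise Berge copy of F. Follow alternating paths starting at the
   unassigned hyperedges. By maximality every pair met on such a path is full; these pairs are
   coloured blue, so each reachable hyperedge is a blue r-clique. An unreachable hyperedge is
   assigned to a pair that is not blue, and there are at most t of them for each red pair and at
   most t - 1 for each pair outside G. *)

theory Submission imports Defs begin

section \<open>Capacitated assignments and alternating paths\<close>

definition load :: "('b \<Rightarrow> 'p option) \<Rightarrow> 'p \<Rightarrow> nat" where
  "load m p = card {A. m A = Some p}"

text \<open>A matching between \<open>E\<close> and the sets \<open>N A\<close> with capacity 1 on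
  hyperedges and capacity \<open>t\<close> on pairs. As its domain lies in \<open>E\<close>,
  finiteness of \<open>E\<close> makes every \<open>load\<close> the cardinality of a finite
  set.\<close>

definition assignment :: "nat \<Rightarrow> 'b set \<Rightarrow> ('b \<Rightarrow> 'p set) \<Rightarrow> ('b \<Rightarrow> 'p option) \<Rightarrow> bool" where
  "assignment t E N m \<longleftrightarrow> (\<forall>A p. m A = Some p \<longrightarrow> A \<in> E \<and> p \<in> N A) \<and> (\<forall>p. load m p \<le> t)"

text \<open>The last argument collects the hyperedges visited so far: only a path without repetitions can
  be switched one step at a time, because then \<open>m\<close> is still unchanged at its next hyperedge.\<close>

inductive alternating :: "'b set \<Rightarrow> ('b \<Rightarrow> 'p set) \<Rightarrow> ('b \<Rightarrow> 'p option) \<Rightarrow> 'b \<Rightarrow> 'b set \<Rightarrow> bool"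
  for E N m where
  start: "A \<in> E \<Longrightarrow> m A = None \<Longrightarrow> alternating E N m A {A}"
| step: "alternating E N m A V \<Longrightarrow> p \<in> N A \<Longrightarrow> m B = Some p \<Longrightarrow> B \<in> E \<Longrightarrow> B \<notin> V
    \<Longrightarrow> alternating E N m B (insert B V)"

text \<open>Each visited hyperedge ends an initial segment of the path. So a hyperedge that cannot
  extend a path because it is already on it is reachable anyway.\<close>

lemma alternating_prefix:
  assumes "alternating E N m A V" and "B \<in> V"
  shows "\<exists>W. alternating E N m B W"
  using assms by induction (auto intro: alternating.intros)

lemma alternating_in:
  assumes "alternating E N m A V"
  shows "A \<in> E" and "A \<in> V"
  using assms by (induction) auto

lemma assignment_dom: "assignment t E N m \<Longrightarrow> dom m \<subseteq> E"
  by (auto simp: assignment_def)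

lemma finite_preimage:
  assumes "finite E" and "assignment t E N m"
  shows "finite {A. m A = Some p}"
  by (rule finite_subset[OF _ assms(1)]) (use assms(2) in \<open>auto simp: assignment_def\<close>)

text \<open>Every hyperedge of the path takes over the pair of its successor, and the last one
  becomes free. Each pair taken over loses one hyperedge and gains one. Agreement with
  \<open>m\<close> off \<open>V\<close> carries the induction: the next hyperedge still has its
  original pair.\<close>

lemma alternating_switch:
  assumes "alternating E N m A V" and "finite E" and "assignment t E N m"
  shows "\<exists>m'. assignment t E N m' \<and> m' A = None \<and> (\<forall>p. load m' p = load m p)
    \<and> card (dom m') = card (dom m) \<and> (\<forall>B. B \<notin> V \<longrightarrow> m' B = m B)"
  using assms
proof induction
  case (start A)
  then show ?case by blast
next
  case (step A V p B)
  then obtain m' where m': "assignment t E N m'" "m' A = None" "\<And>q. load m' q = load m q"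
    "card (dom m') = card (dom m)" "\<And>B. B \<notin> V \<Longrightarrow> m' B = m B"
    by blast
  have A: "A \<in> E" "A \<in> V" using alternating_in[OF step.hyps(1)] by auto
  have AB: "A \<noteq> B" using A step.hyps by auto
  have mB: "m' B = Some p" using m' step.hyps by simp
  \<comment> \<open>By induction \<open>A\<close> is already free, so it can receive the pair that
    \<open>B\<close> gives up.\<close>
  let ?m = "m'(A := Some p, B := None)"
  have load: "load ?m q = load m' q" for q
  proof (cases "q = p")
    case True
    have "{C. ?m C = Some p} = insert A ({C. m' C = Some p} - {B})"
      using AB m'(2) by auto
    moreover have "card (insert A ({C. m' C = Some p} - {B})) = card {C. m' C = Some p}"
      using card_Suc_Diff1[of "{C. m' C = Some p}" B] finite_preimage[OF step.prems(1) m'(1)] mB m'(2)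
      by simp
    ultimately show ?thesis using True by (simp add: load_def)
  next
    case False
    then have "{C. ?m C = Some q} = {C. m' C = Some q}"
      using AB m'(2) mB by auto
    then show ?thesis by (simp only: load_def)
  qed
  have "finite (dom m')"
    using step.prems(1) assignment_dom[OF m'(1)] finite_subset by blast
  moreover have "dom ?m = insert A (dom m' - {B})" using AB by auto
  ultimately have "card (dom ?m) = card (dom m')"
    using card_Suc_Diff1[of "dom m'" B] m'(2) mB by (simp add: domIff domI)
  moreover have "assignment t E N ?m"
    using m'(1) load step.hyps(2) A(1) unfolding assignment_def by (auto split: if_splits)
  moreover have "\<forall>C. C \<notin> insert B V \<longrightarrow> ?m C = m C"
    using m'(5) A(2) by auto
  ultimately show ?case
    using m'(3,4) load by (intro exI[of _ ?m]) (simp only: fun_upd_same simp_thms)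
qed

text \<open>\<open>R\<close> is the set of hyperedges reachable from unassigned ones, for an
  assignment with largest domain. A pair below capacity next to \<open>R\<close> would allow an
  augmentation, and a hyperedge outside \<open>R\<close> that is unassigned, or assigned to a pair
  next to \<open>R\<close>, would be reachable.\<close>

lemma maximal_assignment:
  fixes N :: "'b \<Rightarrow> 'p set"
  assumes fin: "finite E"
  obtains m R where "assignment t E N m" and "R \<subseteq> E"
    and "\<And>A p. A \<in> R \<Longrightarrow> p \<in> N A \<Longrightarrow> load m p = t"
    and "\<And>B. B \<in> E - R \<Longrightarrow> \<exists>p. m B = Some p \<and> (\<forall>A\<in>R. p \<notin> N A)"
proof -
  have "assignment t E N Map.empty" by (simp add: assignment_def load_def)
  moreover have "\<forall>m. assignment t E N m \<longrightarrow> card (dom m) < Suc (card E)"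
    using card_mono[OF fin assignment_dom] by (auto simp: less_Suc_eq_le)
  ultimately obtain m where m: "assignment t E N m"
    and max: "\<And>m'. assignment t E N m' \<Longrightarrow> card (dom m') \<le> card (dom m)"
    using ex_has_greatest_nat[of "assignment t E N" Map.empty "\<lambda>m. card (dom m)" "Suc (card E)"]
    by blast
  define R where "R = {A. \<exists>V. alternating E N m A V}"
  have full: "load m p = t" if "A \<in> R" and p: "p \<in> N A" for A p
  proof (rule ccontr)
    assume "load m p \<noteq> t"
    then have less: "load m p < t" using m by (auto simp: assignment_def le_less)
    obtain V where V: "alternating E N m A V" using \<open>A \<in> R\<close> R_def by blast
    then obtain m' where m': "assignment t E N m'" "m' A = None" "\<And>q. load m' q = load m q"
      "card (dom m') = card (dom m)"
      using alternating_switch[OF V fin m] by blast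
    \<comment> \<open>Switching has freed \<open>A\<close> and left \<open>p\<close> below capacity,
      so assigning \<open>A\<close> to \<open>p\<close> enlarges the domain, against
      maximality.\<close>
    let ?m = "m'(A := Some p)"
    have "load ?m q \<le> t" for q
    proof (cases "q = p")
      case True
      have "{C. ?m C = Some p} = insert A {C. m' C = Some p}" by auto
      then have "load ?m p \<le> Suc (load m' p)"
        by (simp add: load_def card_insert_if finite_preimage[OF fin m'(1)])
      then show ?thesis using True less m'(3) by simp
    next
      case False
      then have "{C. ?m C = Some q} = {C. m' C = Some q}" using m'(2) by auto
      then have "load ?m q = load m' q" by (simp only: load_def)
      then show ?thesis using m'(1) by (simp add: assignment_def)
    qed
    then have "assignment t E N ?m"
      using m'(1) p alternating_in[OF V] unfolding assignment_def by auto
    moreover have "finite (dom m')"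
      using fin assignment_dom[OF m'(1)] finite_subset by blast
    then have "card (dom ?m) = Suc (card (dom m'))"
      using m'(2) by (simp add: domIff)
    ultimately show False using max[of ?m] m'(4) by simp
  qed
  have rest: "\<exists>p. m B = Some p \<and> (\<forall>A\<in>R. p \<notin> N A)" if B: "B \<in> E - R" for B
  proof (cases "m B")
    case None
    then show ?thesis using B alternating.start[of B E m N] R_def by auto
  next
    case (Some p)
    have "p \<notin> N A" if A: "A \<in> R" for A
    proof
      assume p: "p \<in> N A"
      obtain V where V: "alternating E N m A V" using A R_def by blast
      \<comment> \<open>Either \<open>B\<close> lies on the path already, and an initial segment
        ends there, or the path extends to \<open>B\<close>.\<close>
      have "B \<in> R"
        using alternating_prefix[OF V] alternating.step[OF V p Some] B R_def by blast
      then show False using B by simp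
    qed
    then show ?thesis using Some by simp
  qed
  have "R \<subseteq> E" by (auto simp: R_def dest: alternating_in(1))
  then show thesis by (rule that[OF m _ full rest])
qed

section \<open>Counting copies and cliques\<close>

lemma isomorphic_refl: "isomorphic S S"
  unfolding isomorphic_def by (rule exI[of _ id]) simp

lemma finite_edges: "wf_hypergraph H \<Longrightarrow> finite (edges H)"
  unfolding wf_hypergraph_def by (meson Pow_iff finite_Pow_iff finite_subset subsetI)

text \<open>Lower bounds on \<open>num_cliques\<close> rely on this, since \<open>card\<close> is 0
  on infinite sets.\<close>

lemma finite_copies:
  fixes H :: "'b hypergraph"
  assumes "wf_hypergraph H"
  shows "finite (copies F H)"
proof (rule finite_subset)
  let ?g = "\<lambda>(V, E). \<lparr>verts = V, edges = E\<rparr> :: 'b hypergraph"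
  show "copies F H \<subseteq> ?g ` (Pow (verts H) \<times> Pow (edges H))"
  proof
    fix S assume "S \<in> copies F H"
    then have "(verts S, edges S) \<in> Pow (verts H) \<times> Pow (edges H)"
      by (auto simp: copies_def subhypergraph_def)
    then show "S \<in> ?g ` (Pow (verts H) \<times> Pow (edges H))"
      by (rule rev_image_eqI) simp
  qed
  show "finite (?g ` (Pow (verts H) \<times> Pow (edges H)))"
    using assms finite_edges[OF assms] by (simp add: wf_hypergraph_def)
qed

text \<open>Each set in \<open>R\<close> spans a complete graph on \<open>r\<close> vertices inside
  \<open>G\<close>, and its vertex set recovers it, so distinct sets give distinct copies.\<close>

lemma num_cliques_ge:
  fixes G :: "'b hypergraph"
  assumes "wf_hypergraph G"
    and R: "\<And>A. A \<in> R \<Longrightarrow> A \<subseteq> verts G \<and> card A = r \<and> (\<forall>e. e \<subseteq> A \<and> card e = 2 \<longrightarrow> e \<in> edges G)"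
  shows "card R \<le> num_cliques r G"
proof -
  let ?K = "\<lambda>A. \<lparr>verts = A, edges = {e. e \<subseteq> A \<and> card e = 2}\<rparr> :: 'b hypergraph"
  have "?K A \<in> copies (complete_graph r) G" if A: "A \<in> R" for A
  proof -
    have finA: "finite A"
      using R[OF A] assms(1) finite_subset by (auto simp: wf_hypergraph_def)
    then obtain f where f: "bij_betw f {..<r} A"
      using R[OF A] by (metis card_lessThan finite_lessThan finite_same_card_bij)
    have "{e. e \<subseteq> A \<and> card e = 2} = (\<lambda>e. f ` e) ` {e. e \<subseteq> {..<r} \<and> card e = 2}"
    proof (intro equalityI subsetI)
      fix e assume e: "e \<in> {e. e \<subseteq> A \<and> card e = 2}"
      then obtain d where d: "d \<subseteq> {..<r}" "e = f ` d"
        using f by (metis (no_types, lifting) bij_betw_imp_surj_on mem_Collect_eq subset_imageE)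
      moreover have "card e = card d"
        using d f by (metis bij_betw_imp_inj_on card_image inj_on_subset)
      ultimately show "e \<in> (\<lambda>e. f ` e) ` {e. e \<subseteq> {..<r} \<and> card e = 2}"
        using e by auto
    next
      fix e assume "e \<in> (\<lambda>e. f ` e) ` {e. e \<subseteq> {..<r} \<and> card e = 2}"
      then obtain d where d: "d \<subseteq> {..<r}" "card d = 2" "e = f ` d" by auto
      moreover have "card e = card d"
        using d f by (metis bij_betw_imp_inj_on card_image inj_on_subset)
      ultimately show "e \<in> {e. e \<subseteq> A \<and> card e = 2}"
        using f by (auto simp: bij_betw_def)
    qed
    then have "isomorphic (complete_graph r) (?K A)"
      using f by (auto simp: isomorphic_def complete_graph_def)
    moreover have "subhypergraph (?K A) G"
      using R[OF A] finA by (auto simp: subhypergraph_def wf_hypergraph_def)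
    ultimately show ?thesis by (simp add: copies_def)
  qed
  then have "?K ` R \<subseteq> copies (complete_graph r) G" by blast
  moreover have "inj_on ?K R" by (rule inj_onI) simp
  ultimately show ?thesis
    unfolding num_cliques_def by (intro card_inj_on_le[of ?K] finite_copies[OF assms(1)])
qed

section \<open>The blue-red graph of a Berge-free hypergraph\<close>

lemma full_pairs_free:
  fixes F :: "'a hypergraph" and H G :: "nat hypergraph"
  assumes H: "wf_hypergraph H" "uniform r H"
    and berge_free: "\<forall>S\<in>(berge_copies t r F :: nat hypergraph set). free S H"
    and F: "wf_hypergraph F"
    and m: "assignment t (edges H) (\<lambda>A. {e. e \<subseteq> A \<and> card e = 2}) m"
    and G: "verts G = verts H" "\<And>p. p \<in> edges G \<Longrightarrow> load m p = t"
  shows "free F G"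
proof (rule ccontr)
  assume "\<not> free F G"
  then obtain S where "S \<in> copies F G" by (auto simp: free_def)
  then obtain f where f: "bij_betw f (verts F) (verts S)" "edges S = (\<lambda>A. f ` A) ` edges F"
    and S: "verts S \<subseteq> verts G" "edges S \<subseteq> edges G"
    by (auto simp: copies_def subhypergraph_def isomorphic_def)
  \<comment> \<open>The image of an edge of \<open>F\<close> is a full pair, so exactly
    \<open>t\<close> hyperedges are assigned to it, all containing it. Distinct edges have distinct
    images and a hyperedge has only one pair, which makes these sets disjoint.\<close>
  define h where "h e = {A. m A = Some (f ` e)}" for e
  have inj: "inj_on f (verts F)" using f(1) by (rule bij_betw_imp_inj_on)
  have sub: "e \<subseteq> verts F" if "e \<in> edges F" for e
    using F that by (auto simp: wf_hypergraph_def)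
  have h_sub: "h e \<subseteq> edges H" for e
    using m by (auto simp: h_def assignment_def)
  have h_card: "card (h e) = t" if "e \<in> edges F" for e
    using G(2) S(2) f(2) that by (auto simp: h_def load_def)
  have h_disj: "h e \<inter> h e' = {}" if "e \<in> edges F" "e' \<in> edges F" "e \<noteq> e'" for e e'
    using inj_on_image_eq_iff[OF inj sub sub] that by (auto simp: h_def)
  \<comment> \<open>All vertices of \<open>H\<close> are kept because the chosen hyperedges may
    leave the image of \<open>f\<close>.\<close>
  define B where "B = \<lparr>verts = verts H, edges = \<Union>(h ` edges F)\<rparr>"
  have "card (\<Union>(h ` edges F)) = (\<Sum>e\<in>edges F. card (h e))"
    using finite_edges[OF F] h_disj finite_subset[OF h_sub finite_edges[OF H(1)]]
    by (intro card_UN_disjoint) auto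
  then have card: "card (edges B) = t * card (edges F)"
    using h_card by (simp add: B_def)
  have B: "wf_hypergraph B" "uniform r B"
    using H h_sub by (auto simp: B_def wf_hypergraph_def uniform_def dest: subsetD[OF h_sub])
  have "B \<in> berge_copies t r F"
    unfolding berge_copies_def mem_Collect_eq
  proof (intro conjI B card exI[of _ f] exI[of _ h] inj ballI impI allI)
    show "f ` verts F \<subseteq> verts B"
      using f(1) S(1) G(1) by (auto simp: B_def bij_betw_def)
    show "h e \<subseteq> edges B" if "e \<in> edges F" for e using that by (auto simp: B_def)
    show "{f x, f y} \<subseteq> A" if "A \<in> h {x, y}" for x y A
      using m that by (auto simp: h_def assignment_def)
  qed (use h_card h_disj in auto)
  then have "free B H" by (rule bspec[OF berge_free])
  moreover have "B \<in> copies B H"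
    using B(1) h_sub by (auto simp: copies_def isomorphic_refl subhypergraph_def B_def)
  ultimately show False by (simp add: free_def)
qed

lemma blue_red_graph:
  fixes F :: "'a hypergraph" and H :: "nat hypergraph"
  assumes H: "wf_hypergraph H" "uniform r H"
    and berge_free: "\<forall>S\<in>(berge_copies t r F :: nat hypergraph set). free S H"
    and F: "wf_hypergraph F"
  shows "\<exists>(G :: nat hypergraph) c. simple_graph G \<and> verts G = verts H \<and> free F G \<and>
    card (edges H)
      \<le> num_cliques r (colour_subgraph G c Blue)
        + t * card (edges (colour_subgraph G c Red))
        + (t - 1) * ((card (verts H) choose 2) - card (edges G))"
proof -
  let ?N = "\<lambda>A::nat set. {e. e \<subseteq> A \<and> card e = 2}"
  obtain m R where m: "assignment t (edges H) ?N m" and R: "R \<subseteq> edges H"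
    and full: "\<And>A p. A \<in> R \<Longrightarrow> p \<in> ?N A \<Longrightarrow> load m p = t"
    and rest: "\<And>B. B \<in> edges H - R \<Longrightarrow> \<exists>p. m B = Some p \<and> (\<forall>A\<in>R. p \<notin> ?N A)"
    by (rule maximal_assignment[OF finite_edges[OF H(1)], of t ?N]) (rule that)
  have finV: "finite (verts H)" using H(1) by (simp add: wf_hypergraph_def)
  define P where "P = ?N (verts H)"
  have finP: "finite P" and cardP: "card P = card (verts H) choose 2"
    using finV n_subsets[OF finV, of 2] by (auto simp: P_def)
  define G where "G = \<lparr>verts = verts H, edges = {p \<in> P. load m p = t}\<rparr>"
  \<comment> \<open>Blue marks the pairs inside reachable hyperedges. By \<open>full\<close> these
    all belong to \<open>G\<close>, so each member of \<open>R\<close> spans a blue clique.\<close>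
  define c where "c p = (if \<exists>A\<in>R. p \<in> ?N A then Blue else Red)" for p
  define red where "red = edges (colour_subgraph G c Red)"
  have sub: "A \<subseteq> verts H" if "A \<in> edges H" for A
    using H(1) that by (auto simp: wf_hypergraph_def)
  have simple: "simple_graph G"
    using finV by (auto simp: simple_graph_def wf_hypergraph_def uniform_def G_def P_def)
  have free: "free F G"
    by (rule full_pairs_free[OF H berge_free F m]) (auto simp: G_def)
  have "card R \<le> num_cliques r (colour_subgraph G c Blue)"
  proof (rule num_cliques_ge)
    show "wf_hypergraph (colour_subgraph G c Blue)"
      using simple by (auto simp: simple_graph_def wf_hypergraph_def colour_subgraph_def)
    show "A \<subseteq> verts (colour_subgraph G c Blue) \<and> card A = r \<and>
        (\<forall>e. e \<subseteq> A \<and> card e = 2 \<longrightarrow> e \<in> edges (colour_subgraph G c Blue))" if A: "A \<in> R" for A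
    proof -
      have "A \<in> edges H" using A R by blast
      then show ?thesis
        using A full[OF A] sub[of A] H(2)
        by (auto simp: colour_subgraph_def G_def P_def c_def uniform_def)
    qed
  qed
  moreover have "card (edges H - R) \<le> t * card red + (t - 1) * card (P - edges G)"
  proof -
    \<comment> \<open>By \<open>rest\<close>, a hyperedge outside \<open>R\<close> is assigned to a
      pair that is not blue, hence to one of \<open>?Q\<close>. Summing loads over \<open>?Q\<close>
      bounds their number.\<close>
    let ?Q = "red \<union> (P - edges G)"
    have finQ: "finite red" "finite (P - edges G)"
      using finP by (auto simp: red_def colour_subgraph_def G_def)
    have "edges H - R \<subseteq> (\<Union>p\<in>?Q. {A. m A = Some p})"
    proof
      fix B assume B: "B \<in> edges H - R"
      then obtain p where p: "m B = Some p" "\<forall>A\<in>R. p \<notin> ?N A" using rest by blast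
      moreover have "p \<in> ?N B" using m p(1) unfolding assignment_def by blast
      ultimately have "p \<in> P" using B sub[of B] by (auto simp: P_def)
      with p(2) have "p \<in> ?Q" by (auto simp: red_def colour_subgraph_def G_def c_def)
      then show "B \<in> (\<Union>p\<in>?Q. {A. m A = Some p})" using p(1) by blast
    qed
    then have "card (edges H - R) \<le> card (\<Union>p\<in>?Q. {A. m A = Some p})"
      using finQ finite_preimage[OF finite_edges[OF H(1)] m] by (intro card_mono) auto
    also have "\<dots> \<le> (\<Sum>p\<in>?Q. load m p)"
      unfolding load_def using finQ by (intro card_UN_le) auto
    also have "\<dots> = (\<Sum>p\<in>red. load m p) + (\<Sum>p\<in>P - edges G. load m p)"
      using finQ by (intro sum.union_disjoint) (auto simp: red_def colour_subgraph_def)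
    also have "\<dots> \<le> t * card red + (t - 1) * card (P - edges G)"
    proof (rule add_mono)
      show "(\<Sum>p\<in>red. load m p) \<le> t * card red"
        using sum_bounded_above[of red "load m" t] m by (simp add: assignment_def mult.commute)
      \<comment> \<open>A pair outside \<open>G\<close> is not full, so its load is strictly below
        \<open>t\<close>.\<close>
      have "load m p \<le> t - 1" if "p \<in> P - edges G" for p
      proof -
        have "load m p \<le> t" "load m p \<noteq> t"
          using m that by (auto simp: assignment_def G_def)
        then show ?thesis by simp
      qed
      then show "(\<Sum>p\<in>P - edges G. load m p) \<le> (t - 1) * card (P - edges G)"
        using sum_bounded_above[of "P - edges G" "load m" "t - 1"] by (simp add: mult.commute)
    qed
    finally show ?thesis .
  qed
  \<comment> \<open>The edges of \<open>G\<close> lie in \<open>P\<close>, so the natural-number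
    subtraction is exact.\<close>
  moreover have "card (P - edges G) = (card (verts H) choose 2) - card (edges G)"
    using finP cardP by (subst card_Diff_subset) (auto simp: G_def)
  moreover have "card (edges H) = card R + card (edges H - R)"
    using R finite_edges[OF H(1)] by (metis card_Diff_subset card_mono finite_subset le_add_diff_inverse)
  ultimately have "card (edges H) \<le> num_cliques r (colour_subgraph G c Blue)
      + t * card (edges (colour_subgraph G c Red))
      + (t - 1) * ((card (verts H) choose 2) - card (edges G))"
    unfolding red_def by simp
  with simple free show ?thesis by (intro exI[of _ G] exI[of _ c]) (simp add: G_def)
qed

section \<open>Existence of an extremal hypergraph\<close>

text \<open>This provides a hypergraph that qualifies for the maximum. If \<open>F\<close> has an
  edge, \<open>t \<ge> 1\<close> forces a hyperedge in every Berge copy; otherwise \<open>F\<close>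
  has too many vertices to fit.\<close>

lemma edgeless_berge_free:
  fixes H :: "'b hypergraph"
  assumes "t \<ge> 1" and "wf_hypergraph F" and "wf_hypergraph H" and "edges H = {}"
    and F: "edges F \<noteq> {} \<or> card (verts H) < card (verts F)"
    and S: "S \<in> berge_copies t r F"
  shows "free S H"
proof (rule ccontr)
  assume "\<not> free S H"
  then obtain T where "T \<in> copies S H" by (auto simp: free_def)
  then have T: "verts T \<subseteq> verts H" "edges T \<subseteq> edges H" and "isomorphic S T"
    by (auto simp: copies_def subhypergraph_def)
  then obtain g where g: "bij_betw g (verts S) (verts T)" "edges T = (\<lambda>A. g ` A) ` edges S"
    unfolding isomorphic_def by blast
  have "edges S = {}" using T g assms(4) by auto
  then have "edges F = {}"
    using S assms(1) finite_edges[OF assms(2)] by (auto simp: berge_copies_def)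
  then have less: "card (verts H) < card (verts F)" using F by simp
  obtain i where "inj_on i (verts F)" "i ` verts F \<subseteq> verts S" "finite (verts S)"
    using S by (auto simp: berge_copies_def wf_hypergraph_def)
  then have "card (verts F) \<le> card (verts S)" by (rule card_inj_on_le)
  also have "\<dots> = card (verts T)" using g(1) by (rule bij_betw_same_card)
  also have "\<dots> \<le> card (verts H)"
    using T(1) assms(3) by (auto intro: card_mono simp: wf_hypergraph_def)
  finally show False using less by simp
qed

text \<open>\<open>Max\<close> is attained on a finite nonempty set: \<open>H0\<close> gives
  nonemptiness, and hyperedges, being distinct subsets of an \<open>n\<close>-set, number at most
  \<open>2 ^ n\<close>.\<close>

lemma ex_number_attained:
  fixes H0 :: "nat hypergraph"
  assumes "wf_hypergraph H0" "uniform r H0" "card (verts H0) = n" "\<forall>S\<in>\<F>. free S H0"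
  obtains H :: "nat hypergraph" where "wf_hypergraph H" "uniform r H" "card (verts H) = n"
    "\<forall>S\<in>\<F>. free S H" "ex_number r n \<F> = card (edges H)"
proof -
  let ?X = "{card (edges H) | H :: nat hypergraph.
     wf_hypergraph H \<and> uniform r H \<and> card (verts H) = n \<and> (\<forall>S\<in>\<F>. free S H)}"
  have "card (edges H) \<le> 2 ^ n" if "wf_hypergraph H" "card (verts H) = n" for H :: "nat hypergraph"
    using that card_mono[of "Pow (verts H)" "edges H"]
    by (auto simp: wf_hypergraph_def card_Pow)
  then have "?X \<subseteq> {..2 ^ n}" by auto
  then have "finite ?X" by (rule finite_subset) simp
  moreover have "?X \<noteq> {}" using assms by blast
  ultimately have "ex_number r n \<F> \<in> ?X" unfolding ex_number_def by (rule Max_in)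
  then show thesis using that by auto
qed

text \<open>The last assumption excludes an edgeless \<open>F\<close> with at most \<open>n\<close>
  vertices: every graph on \<open>n\<close> vertices contains such an \<open>F\<close>, so no
  \<open>F\<close>-free \<open>G\<close> exists.\<close>

theorem theorem1:
  fixes F :: "'a hypergraph" and r t n :: nat
  assumes "r \<ge> 2" and "t \<ge> 1"
    and "simple_graph F"
    and "edges F \<noteq> {} \<or> n < card (verts F)"
  shows "\<exists>(G :: nat hypergraph) c. simple_graph G \<and> card (verts G) = n \<and> free F G \<and>
    ex_number r n (berge_copies t r F)
      \<le> num_cliques r (colour_subgraph G c Blue)
        + t * card (edges (colour_subgraph G c Red))
        + (t - 1) * ((n choose 2) - card (edges G))"
proof -
  have F: "wf_hypergraph F" using assms(3) by (simp add: simple_graph_def)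
  let ?H0 = "\<lparr>verts = {..<n}, edges = {}\<rparr> :: nat hypergraph"
  have H0: "wf_hypergraph ?H0" "uniform r ?H0" "card (verts ?H0) = n"
    by (auto simp: wf_hypergraph_def uniform_def)
  have H0_free: "\<forall>S\<in>(berge_copies t r F :: nat hypergraph set). free S ?H0"
    using edgeless_berge_free[OF assms(2) F H0(1)] assms(4) by auto
  obtain H :: "nat hypergraph" where H: "wf_hypergraph H" "uniform r H" "card (verts H) = n"
    "\<forall>S\<in>(berge_copies t r F :: nat hypergraph set). free S H"
    "ex_number r n (berge_copies t r F) = card (edges H)"
    by (rule ex_number_attained[OF H0 H0_free]) (rule that)
  \<comment> \<open>The bound for Berge-free hypergraphs is applied to an extremal one.\<close>
  show ?thesis
    using blue_red_graph[OF H(1,2,4) F] unfolding H(3,5) by (metis H(3))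
qed

end
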